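(* Let $k\ge 3$ and let $\mathfrak{g}=V_1\oplus\dots\oplus V_k$ be a $k$-step nilpotent naturally graded Lie algebra over $\mathbb{C}$, where the given decomposition is a Carnot grading. Suppose there exist two linearly independent commuting elements $a_1,a_2\in V_1$ (that is, $[a_1,a_2]=0$) and an element $y\in V_k$ such that $$y\notin [\mathfrak{g}^2,\mathfrak{g}^2]+[a_1,\mathfrak{g}^2]+[a_2,\mathfrak{g}^2].$$ Then $\mathfrak{g}$ is not $k$-rigid.
   Context: All Lie algebras are finite dimensional over $\mathbb{C}$. For a Lie algebra $\mathfrak{g}$ put $\mathfrak{g}^1=\mathfrak{g}$, $\mathfrak{g}^{i+1}=[\mathfrak{g},\mathfrak{g}^i]$ (so $\mathfrak{g}^2=[\mathfrak{g},\mathfrak{g}]$). $\mathfrak{g}$ is $k$-step nilpotent if $\mathfrak{g}^{k+1}=0$ and $\mathfrak{g}^k\neq 0$, and at most $k$-step nilpotent if $\mathfrak{g}^{k+1}=0$. $\mathfrak{g}$ is naturally graded if it is isomorphic to its associated graded Lie algebra $\bigoplus_{i\ge1}\mathfrak{g}^i/\mathfrak{g}^{i+1}$ (with the induced bracket); equivalently, it has a Carnot grading, i.e. a vector space decomposition $\mathfrak{g}=V_1\oplus\dots\oplus V_k$ with $[V_i,V_j]\subseteq V_{i+j}$ (where $V_l=0$ for $l>k$) and $\mathfrak{g}^i=V_i\oplus\dots\oplus V_k$ for all $1\le i\le k$. $[A,B]$ denotes the linear span of brackets of elements of $A$ and $B$, and $[a,B]=\{[a,b]:b\in B\}$. Rigidity.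 Let $\mathcal{N}_{n,k}$ be the algebraic variety of all Lie brackets $\mu$ on $\mathbb{C}^n$ such that $(\mathbb{C}^n,\mu)$ is at most $k$-step nilpotent. The group $GL(n,\mathbb{C})$ acts on it by $g\cdot\mu(x,y)=g\,\mu(g^{-1}x,g^{-1}y)$, and the orbit $\mathcal{O}(\mu)$ is the isomorphism class of $\mu$. A bracket $\mu\in\mathcal{N}_{n,k}$ (or the corresponding Lie algebra of dimension $n$) is called $k$-rigid if $\mathcal{O}(\mu)$ is Zariski open in $\mathcal{N}_{n,k}$. *)

theory Defs
  imports "HOL-Analysis.Analysis" "HOL-Library.Set_Algebras"
begin

section \<open>Complex Lie algebras\<close>

locale complex_lie_algebra = vector_space scl
  for scl :: "complex \<Rightarrow> 'g::ab_group_add \<Rightarrow> 'g" +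
  fixes bracket :: "'g \<Rightarrow> 'g \<Rightarrow> 'g"
  assumes linear_right: "Vector_Spaces.linear scl scl (\<lambda>y. bracket x y)"
    and linear_left: "Vector_Spaces.linear scl scl (\<lambda>x. bracket x y)"
    and alternating: "bracket x x = 0"
    and jacobi: "bracket x (bracket y z) + bracket y (bracket z x) + bracket z (bracket x y) = 0"

definition bracket_span ::
    "(complex \<Rightarrow> 'g::ab_group_add \<Rightarrow> 'g) \<Rightarrow> ('g \<Rightarrow> 'g \<Rightarrow> 'g) \<Rightarrow> 'g set \<Rightarrow> 'g set \<Rightarrow> 'g set" where
  "bracket_span scl br A B = module.span scl {br a b | a b. a \<in> A \<and> b \<in> B}"

text \<open>The series is indexed from 1; the value at 0 is a dummy.\<close>

fun lower_central ::
    "(complex \<Rightarrow> 'g::ab_group_add \<Rightarrow> 'g) \<Rightarrow> ('g \<Rightarrow> 'g \<Rightarrow> 'g) \<Rightarrow> nat \<Rightarrow> 'g set" where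
  "lower_central scl br 0 = UNIV"
| "lower_central scl br (Suc 0) = UNIV"
| "lower_central scl br (Suc (Suc i)) =
     bracket_span scl br UNIV (lower_central scl br (Suc i))"

definition at_most_step_nilpotent ::
    "(complex \<Rightarrow> 'g::ab_group_add \<Rightarrow> 'g) \<Rightarrow> ('g \<Rightarrow> 'g \<Rightarrow> 'g) \<Rightarrow> nat \<Rightarrow> bool" where
  "at_most_step_nilpotent scl br k \<longleftrightarrow> lower_central scl br (k + 1) = {0}"

definition step_nilpotent ::
    "(complex \<Rightarrow> 'g::ab_group_add \<Rightarrow> 'g) \<Rightarrow> ('g \<Rightarrow> 'g \<Rightarrow> 'g) \<Rightarrow> nat \<Rightarrow> bool" where
  "step_nilpotent scl br k \<longleftrightarrow>
     lower_central scl br (k + 1) = {0} \<and> lower_central scl br k \<noteq> {0}"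

definition family_sum :: "(nat \<Rightarrow> 'g::ab_group_add set) \<Rightarrow> nat set \<Rightarrow> 'g set" where
  "family_sum V I = {\<Sum>i\<in>I. v i | v. \<forall>i\<in>I. v i \<in> V i}"

definition carnot_grading ::
    "(complex \<Rightarrow> 'g::ab_group_add \<Rightarrow> 'g) \<Rightarrow> ('g \<Rightarrow> 'g \<Rightarrow> 'g) \<Rightarrow> nat \<Rightarrow> (nat \<Rightarrow> 'g set) \<Rightarrow> bool" where
  "carnot_grading scl br k V \<longleftrightarrow>
     (\<forall>i\<in>{1..k}. module.subspace scl (V i)) \<and>
     family_sum V {1..k} = UNIV \<and>
     (\<forall>v. (\<forall>i\<in>{1..k}. v i \<in> V i) \<and> (\<Sum>i=1..k. v i) = 0 \<longrightarrow> (\<forall>i\<in>{1..k}. v i = 0)) \<and>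
     (\<forall>i\<in>{1..k}. \<forall>j\<in>{1..k}.
        bracket_span scl br (V i) (V j) \<subseteq> (if i + j \<le> k then V (i + j) else {0})) \<and>
     (\<forall>i\<in>{1..k}. lower_central scl br i = family_sum V {i..k})"

section \<open>The variety of nilpotent Lie brackets and rigidity\<close>

text \<open>The polynomial functions in the structure constants
  \<open>\<mu> (axis i 1) (axis j 1) $ l\<close>.  They see a map \<open>\<mu>\<close> only through its values on the
  standard basis, so they describe the Zariski topology once restricted to bilinear maps.\<close>

inductive_set structure_polynomials ::
    "((complex ^ 'n::finite \<Rightarrow> complex ^ 'n \<Rightarrow> complex ^ 'n) \<Rightarrow> complex) set" where
  const: "(\<lambda>\<mu>. c) \<in> structure_polynomials"
| coord: "(\<lambda>\<mu>. \<mu> (axis i 1) (axis j 1) $ l) \<in> structure_polynomials"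
| add: "p \<in> structure_polynomials \<Longrightarrow> q \<in> structure_polynomials
         \<Longrightarrow> (\<lambda>\<mu>. p \<mu> + q \<mu>) \<in> structure_polynomials"
| mult: "p \<in> structure_polynomials \<Longrightarrow> q \<in> structure_polynomials
         \<Longrightarrow> (\<lambda>\<mu>. p \<mu> * q \<mu>) \<in> structure_polynomials"

definition zariski_topology :: "(complex ^ 'n::finite \<Rightarrow> complex ^ 'n \<Rightarrow> complex ^ 'n) topology" where
  "zariski_topology =
     topology (\<lambda>U. \<exists>P \<subseteq> structure_polynomials. - U = {\<mu>. \<forall>p\<in>P. p \<mu> = 0})"

lemma openin_zariski_topology:
  fixes U :: "(complex ^ 'n::finite \<Rightarrow> complex ^ 'n \<Rightarrow> complex ^ 'n) set"
  shows "openin zariski_topology U \<longleftrightarrow>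
     (\<exists>P \<subseteq> structure_polynomials. - U = {\<mu>. \<forall>p\<in>P. p \<mu> = 0})"
proof -
  let ?open = "\<lambda>U :: (complex ^ 'n \<Rightarrow> complex ^ 'n \<Rightarrow> complex ^ 'n) set.
    \<exists>P \<subseteq> structure_polynomials. - U = {\<mu>. \<forall>p\<in>P. p \<mu> = 0}"
  have "?open (S \<inter> T)" if S: "?open S" and T: "?open T" for S T
  proof -
    obtain P where P: "P \<subseteq> structure_polynomials" "- S = {\<mu>. \<forall>p\<in>P. p \<mu> = 0}"
      using S by (elim exE conjE)
    obtain Q where Q: "Q \<subseteq> structure_polynomials" "- T = {\<mu>. \<forall>q\<in>Q. q \<mu> = 0}"
      using T by (elim exE conjE)
    let ?R = "\<Union>p\<in>P. (\<lambda>q \<mu>. p \<mu> * q \<mu>) ` Q"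
    have sub: "?R \<subseteq> structure_polynomials"
      by (intro UN_least image_subsetI structure_polynomials.mult subsetD[OF P(1)] subsetD[OF Q(1)])
    have "\<mu> \<in> - (S \<inter> T) \<longleftrightarrow> (\<forall>r\<in>?R. r \<mu> = 0)" for \<mu>
    proof -
      have "\<mu> \<in> - (S \<inter> T) \<longleftrightarrow> (\<forall>p\<in>P. p \<mu> = 0) \<or> (\<forall>q\<in>Q. q \<mu> = 0)"
        unfolding Compl_Int P(2) Q(2) by simp
      also have "\<dots> \<longleftrightarrow> (\<forall>p\<in>P. \<forall>q\<in>Q. p \<mu> * q \<mu> = 0)"
        by (simp only: mult_eq_0_iff) blast
      also have "\<dots> \<longleftrightarrow> (\<forall>r\<in>?R. r \<mu> = 0)"
        by simp
      finally show ?thesis .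
    qed
    then have "- (S \<inter> T) = {\<mu>. \<forall>r\<in>?R. r \<mu> = 0}"
      by (intro set_eqI) (simp only: mem_Collect_eq)
    with sub show ?thesis
      by (intro exI[of _ ?R] conjI)
  qed
  moreover have "?open (\<Union>K)" if K: "\<forall>S\<in>K. ?open S" for K
  proof -
    obtain P where P: "\<forall>S\<in>K. P S \<subseteq> structure_polynomials \<and> - S = {\<mu>. \<forall>p\<in>P S. p \<mu> = 0}"
      using bchoice[OF K] by (elim exE)
    let ?R = "\<Union>S\<in>K. P S"
    have sub: "?R \<subseteq> structure_polynomials"
      using P by (intro UN_least) (drule bspec, assumption, erule conjunct1)
    have "- \<Union>K = (\<Inter>S\<in>K. - S)"
      by blast
    also have "\<dots> = (\<Inter>S\<in>K. {\<mu>. \<forall>p\<in>P S. p \<mu> = 0})"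
      using P by (intro INF_cong refl) (drule bspec, assumption, erule conjunct2)
    also have "\<dots> = {\<mu>. \<forall>p\<in>?R. p \<mu> = 0}"
      by (intro set_eqI) simp
    finally show ?thesis
      using sub by (intro exI[of _ ?R] conjI)
  qed
  ultimately have "istopology ?open"
    unfolding istopology_def by (intro conjI allI impI)
  then show ?thesis
    unfolding zariski_topology_def by (simp only: topology_inverse')
qed

definition nilpotent_brackets ::
    "nat \<Rightarrow> (complex ^ 'n::finite \<Rightarrow> complex ^ 'n \<Rightarrow> complex ^ 'n) set" where
  "nilpotent_brackets k =
     {\<mu>. complex_lie_algebra (*s) \<mu> \<and> at_most_step_nilpotent (*s) \<mu> k}"

definition bracket_orbit ::
    "(complex ^ 'n::finite \<Rightarrow> complex ^ 'n \<Rightarrow> complex ^ 'n)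
      \<Rightarrow> (complex ^ 'n \<Rightarrow> complex ^ 'n \<Rightarrow> complex ^ 'n) set" where
  "bracket_orbit \<mu> =
     {\<lambda>x y. g (\<mu> (inv g x) (inv g y)) | g. Vector_Spaces.linear (*s) (*s) g \<and> bij g}"

definition rigid_bracket ::
    "nat \<Rightarrow> (complex ^ 'n::finite \<Rightarrow> complex ^ 'n \<Rightarrow> complex ^ 'n) \<Rightarrow> bool" where
  "rigid_bracket k \<mu> \<longleftrightarrow>
     \<mu> \<in> nilpotent_brackets k \<and>
     openin (subtopology zariski_topology (nilpotent_brackets k)) (bracket_orbit \<mu>)"

definition lie_isomorphism ::
    "(complex \<Rightarrow> 'g::ab_group_add \<Rightarrow> 'g) \<Rightarrow> ('g \<Rightarrow> 'g \<Rightarrow> 'g)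
      \<Rightarrow> (complex \<Rightarrow> 'h::ab_group_add \<Rightarrow> 'h) \<Rightarrow> ('h \<Rightarrow> 'h \<Rightarrow> 'h) \<Rightarrow> ('g \<Rightarrow> 'h) \<Rightarrow> bool" where
  "lie_isomorphism scl br scl' br' \<phi> \<longleftrightarrow>
     Vector_Spaces.linear scl scl' \<phi> \<and> bij \<phi> \<and> (\<forall>x y. \<phi> (br x y) = br' (\<phi> x) (\<phi> y))"

text \<open>Rigidity of an abstract Lie algebra is rigidity of the corresponding brackets on
  \<open>\<complex>\<^sup>n\<close>; they form one orbit, so \<open>\<exists>\<close> and \<open>\<forall>\<close> agree here.  The dimension \<open>n\<close> of the algebra has
  to be supplied as \<open>CARD('n)\<close>, as \<open>\<complex>\<^sup>n\<close> is the type \<open>complex ^ 'n\<close>.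
  Since \<open>vector_space.dim\<close> is 0 on infinite-dimensional spaces, the equation
  \<open>vector_space.dim scl UNIV = CARD('n)\<close> includes finite dimensionality.\<close>

definition rigid_lie_algebra ::
    "'n::finite itself \<Rightarrow> nat \<Rightarrow> (complex \<Rightarrow> 'g::ab_group_add \<Rightarrow> 'g) \<Rightarrow> ('g \<Rightarrow> 'g \<Rightarrow> 'g) \<Rightarrow> bool" where
  "rigid_lie_algebra (_ :: 'n itself) k scl br \<longleftrightarrow>
     (\<exists>(\<mu> :: complex ^ 'n \<Rightarrow> complex ^ 'n \<Rightarrow> complex ^ 'n) \<phi>.
        lie_isomorphism scl br (*s) \<mu> \<phi> \<and> rigid_bracket k \<mu>)"

end

theory Submission
  imports Defs
begin

text \<open>Choose functionals \<open>\<alpha>\<close>, \<open>\<beta>\<close> that vanish on \<open>\<gg>\<^sup>2\<close> and are dual to \<open>a\<^sub>1\<close>, \<open>a\<^sub>2\<close>, and deform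
  the bracket to \<open>[x, z] + t (\<alpha> x \<beta> z - \<alpha> z \<beta> x) y\<close>.  As \<open>y\<close> is central and lies in \<open>\<gg>\<^sup>2\<close>, this is
  again a Lie bracket, nilpotent of step at most \<open>k\<close>.  If \<open>\<gg>\<close> were rigid, then some deformation
  with \<open>t \<noteq> 0\<close> would be isomorphic to \<open>\<gg>\<close>, say by \<open>f\<close>.  Choose \<open>b\<^sub>i \<in> V\<^sub>1\<close> with
  \<open>f b\<^sub>i \<in> a\<^sub>i + \<gg>\<^sup>2\<close>.  Then \<open>f [b\<^sub>1, b\<^sub>2]\<close> is \<open>t y\<close> plus an element of
  \<open>[\<gg>\<^sup>2, \<gg>\<^sup>2] + [a\<^sub>1, \<gg>\<^sup>2] + [a\<^sub>2, \<gg>\<^sup>2]\<close>, so it lies in \<open>\<gg>\<^sup>3\<close>.  By dimension,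
  \<open>f\<close> maps \<open>\<gg>\<^sup>3\<close> onto itself, so
  \<open>[b\<^sub>1, b\<^sub>2] \<in> V\<^sub>2 \<inter> \<gg>\<^sup>3 = 0\<close>, which exhibits \<open>y\<close> in that sum.\<close>

text \<open>The image has the dimension of \<open>S\<close>, so the inclusion is an equality.
  Applied to the third lower central term, this lets membership be pulled back through an
  isomorphism.\<close>

lemma (in finite_dimensional_vector_space) injective_image_invariant_subspace:
  assumes f: "Vector_Spaces.linear scale scale f" and inj: "inj f"
    and S: "subspace S" and sub: "f ` S \<subseteq> S"
  shows "f ` S = S"
proof -
  interpret p: finite_dimensional_vector_space_pair_1 scale Basis scale
    by unfold_locales
  have "dim (f ` S) = dim S"
    using f inj by (intro p.dim_image_eq) (auto intro: inj_on_subset)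
  moreover have "subspace (f ` S)"
    using f S by (rule p.linear_subspace_image)
  ultimately show ?thesis
    using S sub by (intro subspace_dim_equal) auto
qed

section \<open>Lower central series and the deformed bracket\<close>

context complex_lie_algebra
begin

abbreviation lc :: "nat \<Rightarrow> 'g set" where
  "lc \<equiv> lower_central scl bracket"

lemma bracket_add_right: "bracket x (y + z) = bracket x y + bracket x z"
  using linear_right[of x] by (simp add: Vector_Spaces.linear_iff)

lemma bracket_add_left: "bracket (x + y) z = bracket x z + bracket y z"
  using linear_left[of z] by (simp add: Vector_Spaces.linear_iff)

lemma bracket_scale_right: "bracket x (scl c y) = scl c (bracket x y)"
  using linear_right[of x] by (simp add: Vector_Spaces.linear_iff)

lemma bracket_scale_left: "bracket (scl c x) y = scl c (bracket x y)"
  using linear_left[of y] by (simp add: Vector_Spaces.linear_iff)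

lemma bracket_skew: "bracket x y = - bracket y x"
proof -
  have "0 = bracket (x + y) (x + y)"
    by (rule alternating[symmetric])
  also have "\<dots> = bracket x (x + y) + bracket y (x + y)"
    by (rule bracket_add_left)
  also have "\<dots> = bracket y x + bracket x y"
    by (simp add: bracket_add_right alternating add.commute)
  finally have "bracket y x + bracket x y = 0"
    by (rule sym)
  then show ?thesis
    by (rule minus_unique[symmetric])
qed

lemma subspace_lower_central: "subspace (lc i)"
  by (cases "(scl, bracket, i)" rule: lower_central.cases)
     (auto simp: bracket_span_def subspace_UNIV)

lemma bracket_mem_lower_central: "w \<in> lc (Suc i) \<Longrightarrow> bracket x w \<in> lc (Suc (Suc i))"
  by (auto simp: bracket_span_def intro: span_base)

text \<open>Brackets against a smaller set have a smaller span, so each inclusion yields the next.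
  Indices 0 and 1 stand apart because both give the whole space and the recursion starts at
  2.\<close>

lemma lower_central_Suc: "lc (Suc i) \<subseteq> lc i"
proof (induction i rule: less_induct)
  case (less i)
  consider "i = 0" | "i = 1" | j where "i = Suc (Suc j)"
    by (metis One_nat_def not0_implies_Suc)
  then show ?case
  proof cases
    case 3
    have "lc (Suc (Suc j)) \<subseteq> lc (Suc j)"
      using less 3 by blast
    then show ?thesis
      unfolding 3 lower_central.simps(3)[of _ _ "Suc j"] lower_central.simps(3)[of _ _ j]
      unfolding bracket_span_def by (intro span_mono) blast
  qed auto
qed

lemma lower_central_antimono: "i \<le> j \<Longrightarrow> lc j \<subseteq> lc i"
  by (rule lift_Suc_antimono_le[of lc]) (rule lower_central_Suc)

text \<open>The added term is the wedge product of \<open>\<alpha>\<close> and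
  \<open>\<beta>\<close> with values on the line of \<open>y\<close>. The parameter \<open>t\<close>
  is absorbed into \<open>\<alpha>\<close>.\<close>

definition deformation :: "('g \<Rightarrow> complex) \<Rightarrow> ('g \<Rightarrow> complex) \<Rightarrow> 'g \<Rightarrow> 'g \<Rightarrow> 'g \<Rightarrow> 'g" where
  "deformation \<alpha> \<beta> y = (\<lambda>x z. bracket x z + scl (\<alpha> x * \<beta> z - \<alpha> z * \<beta> x) y)"

text \<open>Both functionals kill \<open>y\<close> and all brackets, and \<open>y\<close> is
  central. Hence each iterated deformed bracket equals the iterated original one, and the Jacobi
  identity is inherited.\<close>

lemma complex_lie_algebra_deformation:
  assumes \<alpha>: "Vector_Spaces.linear scl (*) \<alpha>" and \<beta>: "Vector_Spaces.linear scl (*) \<beta>"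
    and \<alpha>0: "\<And>x. x \<in> lc 2 \<Longrightarrow> \<alpha> x = 0" and \<beta>0: "\<And>x. x \<in> lc 2 \<Longrightarrow> \<beta> x = 0"
    and y: "y \<in> lc 2" and central: "\<And>x. bracket x y = 0"
  shows "complex_lie_algebra scl (deformation \<alpha> \<beta> y)"
proof -
  have lin: "\<alpha> (u + v) = \<alpha> u + \<alpha> v" "\<beta> (u + v) = \<beta> u + \<beta> v"
    "\<alpha> (scl c u) = c * \<alpha> u" "\<beta> (scl c u) = c * \<beta> u" for u v c
    using \<alpha> \<beta> by (simp_all add: Vector_Spaces.linear_iff)
  have br2: "bracket u v \<in> lc 2" for u v
    using bracket_mem_lower_central[of v 0 u] by (simp add: numeral_2_eq_2)
  have van: "\<alpha> (bracket u v) = 0" "\<beta> (bracket u v) = 0" "\<alpha> y = 0" "\<beta> y = 0" for u v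
    using br2 y \<alpha>0 \<beta>0 by blast+
  show ?thesis
  proof (intro_locales; unfold complex_lie_algebra_axioms_def; intro conjI allI)
    fix x
    show "Vector_Spaces.linear scl scl (deformation \<alpha> \<beta> y x)"
      unfolding Vector_Spaces.linear_iff deformation_def
      by (auto simp: vector_space_axioms bracket_add_right bracket_scale_right lin algebra_simps
          scale_left_distrib scale_right_distrib scale_left_diff_distrib scale_right_diff_distrib)
  next
    fix z
    show "Vector_Spaces.linear scl scl (\<lambda>x. deformation \<alpha> \<beta> y x z)"
      unfolding Vector_Spaces.linear_iff deformation_def
      by (auto simp: vector_space_axioms bracket_add_left bracket_scale_left lin algebra_simps
          scale_left_distrib scale_right_distrib scale_left_diff_distrib scale_right_diff_distrib)
  next
    fix x show "deformation \<alpha> \<beta> y x x = 0"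
      by (simp add: deformation_def alternating)
  next
    fix u v w
    show "deformation \<alpha> \<beta> y u (deformation \<alpha> \<beta> y v w)
        + deformation \<alpha> \<beta> y v (deformation \<alpha> \<beta> y w u)
        + deformation \<alpha> \<beta> y w (deformation \<alpha> \<beta> y u v) = 0"
      using jacobi[of u v w]
      by (simp add: deformation_def lin van bracket_add_right bracket_scale_right central)
  qed
qed

text \<open>The added term matters only from index 1 to 2, where it is a multiple of
  \<open>y\<close> and so stays in \<open>lc 2\<close>. Later the right factor lies in
  \<open>lc 2\<close>, where both functionals vanish.\<close>

lemma lower_central_deformation:
  assumes \<alpha>0: "\<And>x. x \<in> lc 2 \<Longrightarrow> \<alpha> x = 0" and \<beta>0: "\<And>x. x \<in> lc 2 \<Longrightarrow> \<beta> x = 0"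
    and y: "y \<in> lc 2"
  shows "lower_central scl (deformation \<alpha> \<beta> y) i \<subseteq> lc i"
proof (induction i)
  case 0
  show ?case by simp
next
  case (Suc i)
  show ?case
  proof (cases i)
    case (Suc j)
    have "deformation \<alpha> \<beta> y a b \<in> lc (Suc (Suc j))"
      if "b \<in> lower_central scl (deformation \<alpha> \<beta> y) (Suc j)" for a b
    proof -
      have b: "b \<in> lc (Suc j)"
        using that Suc.IH Suc by blast
      then have ab: "bracket a b \<in> lc (Suc (Suc j))"
        by (rule bracket_mem_lower_central)
      show ?thesis
      proof (cases j)
        case 0
        then show ?thesis
          using ab y subspace_lower_central[of 2]
          by (simp add: deformation_def subspace_add subspace_scale numeral_2_eq_2
                del: lower_central.simps)
      next
        case (Suc m)
        then have "b \<in> lc 2"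
          using b lower_central_antimono[of 2 "Suc j"] by auto
        then show ?thesis
          using ab \<alpha>0 \<beta>0 by (simp add: deformation_def del: lower_central.simps)
      qed
    qed
    then show ?thesis
      unfolding Suc lower_central.simps(3)[of _ "deformation \<alpha> \<beta> y"] bracket_span_def
      by (intro span_minimal subspace_lower_central) blast
  qed simp
qed

lemma at_most_step_nilpotent_deformation:
  assumes "\<And>x. x \<in> lc 2 \<Longrightarrow> \<alpha> x = 0" "\<And>x. x \<in> lc 2 \<Longrightarrow> \<beta> x = 0" "y \<in> lc 2"
    and nil: "at_most_step_nilpotent scl bracket k" and "k > 0"
  shows "at_most_step_nilpotent scl (deformation \<alpha> \<beta> y) k"
proof -
  obtain j where k: "k = Suc j"
    using \<open>k > 0\<close> gr0_conv_Suc by blast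
  have "0 \<in> lower_central scl (deformation \<alpha> \<beta> y) (k + 1)"
    by (simp add: k bracket_span_def span_zero)
  then show ?thesis
    using lower_central_deformation[of \<alpha> \<beta> y "k + 1"] assms
    unfolding at_most_step_nilpotent_def by blast
qed

text \<open>A basis of \<open>span (insert b S)\<close> chosen inside \<open>insert b S\<close>
  stays independent when \<open>a\<close> is added, so a functional can be prescribed as 1 at
  \<open>a\<close> and 0 on that basis.\<close>

lemma exists_dual_functional:
  assumes S: "subspace S" and a: "a \<notin> span (insert b S)"
  shows "\<exists>\<alpha>. Vector_Spaces.linear scl (*) \<alpha> \<and> (\<forall>x\<in>S. \<alpha> x = 0) \<and> \<alpha> b = 0 \<and> \<alpha> a = (1::complex)"
proof -
  interpret p: vector_space_pair scl "(*) :: complex \<Rightarrow> complex \<Rightarrow> complex"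
    by unfold_locales (auto simp: algebra_simps)
  obtain C where C: "C \<subseteq> insert b S" "independent C" "insert b S \<subseteq> span C"
    using maximal_independent_subset[of "insert b S"] by blast
  have sp: "span C = span (insert b S)"
    using C(1,3) by (meson span_mono span_minimal subspace_span subset_antisym)
  have "independent (insert a C)"
    using C(2) a sp by (simp add: independent_insertI)
  then obtain \<alpha> where \<alpha>: "Vector_Spaces.linear scl (*) \<alpha>"
    "\<forall>x\<in>insert a C. \<alpha> x = (if x = a then 1 else 0)"
    using p.linear_independent_extend[of "insert a C" "\<lambda>x. if x = a then 1 else 0"] by blast
  have "a \<notin> C"
    using a sp span_base by blast
  then have "\<alpha> x = 0" if "x \<in> C" for x
    using \<alpha>(2) that by auto
  then have "\<alpha> x = 0" if "x \<in> insert b S" for x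
    using that C(3) p.linear_eq_0_on_span[OF \<alpha>(1), of C x] by blast
  then show ?thesis
    using \<alpha> by (intro exI[of _ \<alpha>]) auto
qed

end

section \<open>Transport of Lie structure along isomorphisms\<close>

lemma lie_isomorphism_inv:
  assumes "lie_isomorphism scl br scl' br' \<phi>"
  shows "lie_isomorphism scl' br' scl br (inv \<phi>)"
proof -
  have lin: "Vector_Spaces.linear scl scl' \<phi>" and bij: "bij \<phi>"
    and hom: "\<And>x y. \<phi> (br x y) = br' (\<phi> x) (\<phi> y)"
    using assms by (auto simp: lie_isomorphism_def)
  have s: "\<phi> (inv \<phi> x) = x" "inv \<phi> (\<phi> z) = z" for x z
    using bij by (simp_all add: bij_is_surj surj_f_inv_f bij_is_inj)
  have "Vector_Spaces.linear scl' scl (inv \<phi>)"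
    using lin unfolding Vector_Spaces.linear_iff by (metis s)
  moreover have "inv \<phi> (br' x y) = br (inv \<phi> x) (inv \<phi> y)" for x y
    by (metis hom s)
  ultimately show ?thesis
    using bij bij_imp_bij_inv by (auto simp: lie_isomorphism_def)
qed

lemma lie_isomorphism_comp:
  assumes "lie_isomorphism s1 b1 s2 b2 \<phi>" "lie_isomorphism s2 b2 s3 b3 \<psi>"
  shows "lie_isomorphism s1 b1 s3 b3 (\<psi> \<circ> \<phi>)"
  using assms unfolding lie_isomorphism_def by (auto intro: Vector_Spaces.linear_compose bij_comp)

text \<open>The transported bracket has the form of the elements of \<open>bracket_orbit\<close>;
  the same fact carries the deformations to \<open>complex ^ 'n\<close>.\<close>

lemma lie_isomorphism_transport:
  assumes "Vector_Spaces.linear scl scl' \<phi>" "bij \<phi>"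
  shows "lie_isomorphism scl br scl' (\<lambda>x y. \<phi> (br (inv \<phi> x) (inv \<phi> y))) \<phi>"
  using assms by (simp add: lie_isomorphism_def bij_is_inj)

lemma complex_lie_algebra_isomorphism:
  assumes "complex_lie_algebra scl br" and iso: "lie_isomorphism scl br scl' br' \<phi>"
  shows "complex_lie_algebra scl' br'"
proof -
  interpret L: complex_lie_algebra scl br by fact
  have lin: "Vector_Spaces.linear scl scl' \<phi>" and bij: "bij \<phi>"
    and hom: "\<And>x y. \<phi> (br x y) = br' (\<phi> x) (\<phi> y)"
    using iso by (auto simp: lie_isomorphism_def)
  interpret lin: Vector_Spaces.linear scl scl' \<phi> by (rule lin)
  define \<psi> where "\<psi> = inv \<phi>"
  have iso': "lie_isomorphism scl' br' scl br \<psi>"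
    unfolding \<psi>_def by (rule lie_isomorphism_inv[OF iso])
  then have lin': "Vector_Spaces.linear scl' scl \<psi>"
    by (simp add: lie_isomorphism_def)
  have br': "br' x y = \<phi> (br (\<psi> x) (\<psi> y))" for x y
    using bij hom by (simp add: \<psi>_def bij_is_surj surj_f_inv_f)
  have \<psi>\<phi>: "\<psi> (\<phi> z) = z" for z
    using bij by (simp add: \<psi>_def bij_is_inj)
  show ?thesis
  proof (intro_locales; unfold complex_lie_algebra_axioms_def; intro conjI allI)
    fix x
    show "Vector_Spaces.linear scl' scl' (br' x)"
      using Vector_Spaces.linear_compose[OF Vector_Spaces.linear_compose[OF lin' L.linear_right] lin]
      unfolding br'[abs_def] o_def .
  next
    fix y
    show "Vector_Spaces.linear scl' scl' (\<lambda>x. br' x y)"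
      using Vector_Spaces.linear_compose[OF Vector_Spaces.linear_compose[OF lin' L.linear_left] lin]
      by (simp add: br' o_def)
  next
    fix x show "br' x x = 0"
      by (simp add: br' L.alternating lin.zero)
  next
    fix x y z
    show "br' x (br' y z) + br' y (br' z x) + br' z (br' x y) = 0"
      by (simp add: br' \<psi>\<phi> L.jacobi lin.zero flip: lin.add)
  qed
qed

text \<open>Linear maps commute with spans, so matching generators suffices. Surjectivity supplies
  the left factors, which range over the whole algebra.\<close>

lemma lower_central_isomorphism:
  assumes iso: "lie_isomorphism scl br scl' br' \<phi>"
  shows "\<phi> ` lower_central scl br i = lower_central scl' br' i"
proof -
  have lin: "Vector_Spaces.linear scl scl' \<phi>" and surj: "surj \<phi>"
    and hom: "\<And>x y. \<phi> (br x y) = br' (\<phi> x) (\<phi> y)"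
    using iso by (auto simp: lie_isomorphism_def bij_is_surj)
  interpret lin: Vector_Spaces.linear scl scl' \<phi> by (rule lin)
  show ?thesis
  proof (induction i)
    case (Suc i)
    show ?case
    proof (cases i)
      case (Suc j)
      have "\<phi> ` {br a b |a b. a \<in> UNIV \<and> b \<in> lower_central scl br (Suc j)}
          = {br' a b |a b. a \<in> UNIV \<and> b \<in> \<phi> ` lower_central scl br (Suc j)}"
      proof -
        have "br' a (\<phi> b) \<in> \<phi> ` {br a b |a b. a \<in> UNIV \<and> b \<in> lower_central scl br (Suc j)}"
          if "b \<in> lower_central scl br (Suc j)" for a b
        proof -
          obtain a' where "a = \<phi> a'"
            using surj by (rule surjE)
          then show ?thesis
            using that hom[of a' b, symmetric] by auto
        qed
        then show ?thesis
          by (auto simp: hom) blast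
      qed
      moreover have "\<phi> ` lower_central scl br (Suc j) = lower_central scl' br' (Suc j)"
        using Suc.IH Suc by simp
      ultimately show ?thesis
        unfolding Suc lower_central.simps(3) bracket_span_def lin.span_image[symmetric] by simp
    qed (simp add: surj)
  qed (simp add: surj)
qed

lemma at_most_step_nilpotent_isomorphism:
  assumes "at_most_step_nilpotent scl br k" and "lie_isomorphism scl br scl' br' \<phi>"
  shows "at_most_step_nilpotent scl' br' k"
proof -
  interpret lin: Vector_Spaces.linear scl scl' \<phi>
    using assms(2) by (simp add: lie_isomorphism_def)
  show ?thesis
    using assms(1) lower_central_isomorphism[OF assms(2), of "k + 1"]
    by (simp add: at_most_step_nilpotent_def lin.zero)
qed

section \<open>A deformation isomorphic to the original algebra\<close>

text \<open>\<open>W\<close> stands for the degree 1 layer; \<open>complement\<close> and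
  \<open>graded\<close> are what the Carnot grading contributes. The deformation parameter appears
  as the value \<open>t\<close> of \<open>\<alpha>\<close> at \<open>a\<^sub>1\<close>.\<close>

lemma (in complex_lie_algebra) isomorphic_deformation_imp_mem:
  assumes fd: "finite_dimensional_vector_space scl B"
    and \<alpha>: "Vector_Spaces.linear scl (*) \<alpha>" and \<beta>: "Vector_Spaces.linear scl (*) \<beta>"
    and \<alpha>0: "\<And>x. x \<in> lc 2 \<Longrightarrow> \<alpha> x = 0" and \<beta>0: "\<And>x. x \<in> lc 2 \<Longrightarrow> \<beta> x = 0"
    and dual: "\<alpha> a\<^sub>1 = t" "\<alpha> a\<^sub>2 = 0" "\<beta> a\<^sub>2 = 1" and "t \<noteq> 0"
    and commute: "bracket a\<^sub>1 a\<^sub>2 = 0" and y: "y \<in> lc 3"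
    and complement: "\<And>x. \<exists>b\<in>W. x - b \<in> lc 2"
    and graded: "\<And>b c. \<lbrakk>b \<in> W; c \<in> W; bracket b c \<in> lc 3\<rbrakk> \<Longrightarrow> bracket b c = 0"
    and iso: "lie_isomorphism scl bracket scl (deformation \<alpha> \<beta> y) f"
  shows "y \<in> bracket_span scl bracket (lc 2) (lc 2) + bracket a\<^sub>1 ` lc 2 + bracket a\<^sub>2 ` lc 2"
proof -
  interpret fd: finite_dimensional_vector_space scl B by (rule fd)
  have lin: "Vector_Spaces.linear scl scl f" and bij: "bij f"
    and hom: "\<And>x z. f (bracket x z) = deformation \<alpha> \<beta> y (f x) (f z)"
    using iso by (auto simp: lie_isomorphism_def)
  interpret lin: Vector_Spaces.linear scl scl f by (rule lin)
  have lin_\<alpha>\<beta>: "\<alpha> (u + v) = \<alpha> u + \<alpha> v" "\<beta> (u + v) = \<beta> u + \<beta> v" for u v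
    using \<alpha> \<beta> by (simp_all add: Vector_Spaces.linear_iff)
  note sub2 = subspace_lower_central[of 2] and sub3 = subspace_lower_central[of 3]
  have y2: "y \<in> lc 2"
    using y lower_central_antimono[of 2 3] by auto
  have br3: "bracket u v \<in> lc 3" if "v \<in> lc 2" for u v
    using bracket_mem_lower_central[of v 1 u] that by (simp add: eval_nat_numeral)
  \<comment> \<open>\<open>f\<close> carries the series of the original bracket onto that of the
    deformed one, which lies inside the original series.\<close>
  have f_lc: "f ` lc i \<subseteq> lc i" for i
    unfolding lower_central_isomorphism[OF iso]
    by (rule lower_central_deformation[OF \<alpha>0 \<beta>0 y2])
  have f3: "f ` lc 3 = lc 3"
    by (rule fd.injective_image_invariant_subspace[OF lin bij_is_inj[OF bij] sub3 f_lc])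
  \<comment> \<open>Take \<open>b\<close> to be the \<open>W\<close>-part of the preimage of
    \<open>a\<close>; the remainder lies in \<open>lc 2\<close>, which \<open>f\<close>
    preserves.\<close>
  have lift: "\<exists>b\<in>W. \<exists>u\<in>lc 2. f b = a + u" for a
  proof -
    obtain b where b: "b \<in> W" "inv f a - b \<in> lc 2"
      using complement by blast
    have "f b = a + - f (inv f a - b)"
      using bij by (simp add: lin.diff bij_is_surj surj_f_inv_f)
    moreover have "- f (inv f a - b) \<in> lc 2"
      using b(2) f_lc[of 2] sub2 by (blast intro: subspace_neg)
    ultimately show ?thesis
      using b(1) by blast
  qed
  obtain b\<^sub>1 u where b1: "b\<^sub>1 \<in> W" "u \<in> lc 2" "f b\<^sub>1 = a\<^sub>1 + u"
    using lift by blast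
  obtain b\<^sub>2 v where b2: "b\<^sub>2 \<in> W" "v \<in> lc 2" "f b\<^sub>2 = a\<^sub>2 + v"
    using lift by blast
  have skew: "bracket u a\<^sub>2 = - bracket a\<^sub>2 u"
    by (rule bracket_skew)
  \<comment> \<open>The coefficient of \<open>y\<close> is \<open>t\<close>: both functionals ignore
    \<open>u\<close> and \<open>v\<close>, and the second product vanishes because
    \<open>\<alpha> a\<^sub>2 = 0\<close>. The term \<open>bracket a\<^sub>1 a\<^sub>2\<close> drops
    out by \<open>commute\<close>.\<close>
  have eq: "f (bracket b\<^sub>1 b\<^sub>2) = bracket u v + bracket a\<^sub>1 v - bracket a\<^sub>2 u + scl t y"
    using b1(2) b2(2) by (simp add: hom b1(3) b2(3) deformation_def lin_\<alpha>\<beta> \<alpha>0 \<beta>0 dual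
        bracket_add_left bracket_add_right commute skew)
  also have "\<dots> \<in> lc 3"
    by (intro subspace_add[OF sub3] subspace_diff[OF sub3] subspace_scale[OF sub3] br3 y b1 b2)
  finally have "bracket b\<^sub>1 b\<^sub>2 \<in> lc 3"
    using f3 bij by (metis bij_is_inj inj_image_mem_iff)
  then have "bracket b\<^sub>1 b\<^sub>2 = 0"
    using graded b1(1) b2(1) by blast
  then have "bracket u v + bracket a\<^sub>1 v - bracket a\<^sub>2 u + scl t y = 0"
    using eq lin.zero by simp
  then have "scl t y = - bracket u v - bracket a\<^sub>1 v + bracket a\<^sub>2 u"
    by (simp add: algebra_simps eq_neg_iff_add_eq_0)
  then have "scl (inverse t) (scl t y) = scl (inverse t) (- bracket u v - bracket a\<^sub>1 v + bracket a\<^sub>2 u)"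
    by simp
  \<comment> \<open>Bilinearity moves the scalar and the signs into the factors from
    \<open>lc 2\<close>, so that each summand lies in the required set.\<close>
  then have "y = bracket (scl (- inverse t) u) v + bracket a\<^sub>1 (scl (- inverse t) v)
      + bracket a\<^sub>2 (scl (inverse t) u)"
    using \<open>t \<noteq> 0\<close>
    by (simp add: bracket_scale_left bracket_scale_right scale_right_diff_distrib
        scale_right_distrib del: scale_minus_left) simp
  moreover have "bracket (scl (- inverse t) u) v \<in> bracket_span scl bracket (lc 2) (lc 2)"
    unfolding bracket_span_def
    using b1(2) b2(2) subspace_scale[OF sub2] by (intro span_base) blast
  moreover have "scl (- inverse t) v \<in> lc 2" "scl (inverse t) u \<in> lc 2"
    using b1(2) b2(2) subspace_scale[OF sub2] by blast+
  ultimately show ?thesis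
    by (metis set_plus_intro imageI)
qed

section \<open>Zariski open sets along continuous curves\<close>

lemma continuous_on_structure_polynomial:
  assumes "p \<in> structure_polynomials"
    and "\<And>i j l. continuous_on S (\<lambda>t. F t (axis i 1) (axis j 1) $ l)"
  shows "continuous_on S (\<lambda>t. p (F t))"
  using assms by (induction p) (auto intro: continuous_on_add continuous_on_mult)

text \<open>Some structure polynomial is nonzero at \<open>F 0\<close> and vanishes outside the open
  set. By continuity it stays nonzero along the curve near 0, and 0 is not isolated in the complex
  plane.\<close>

lemma zariski_open_meets_curve:
  fixes F :: "complex \<Rightarrow> complex ^ 'n::finite \<Rightarrow> complex ^ 'n \<Rightarrow> complex ^ 'n"
  assumes U: "openin (subtopology zariski_topology N) U"
    and "F 0 \<in> U" and FN: "\<And>t. F t \<in> N"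
    and cont: "\<And>i j l. continuous_on UNIV (\<lambda>t. F t (axis i 1) (axis j 1) $ l)"
  shows "\<exists>t. t \<noteq> 0 \<and> F t \<in> U"
proof -
  obtain T where T: "openin zariski_topology T" "U = T \<inter> N"
    using U by (auto simp: openin_subtopology)
  then obtain P where P: "P \<subseteq> structure_polynomials" "- T = {\<mu>. \<forall>p\<in>P. p \<mu> = 0}"
    unfolding openin_zariski_topology by blast
  have memT: "\<mu> \<in> T \<longleftrightarrow> (\<exists>p\<in>P. p \<mu> \<noteq> 0)" for \<mu>
    using P(2) by (simp add: set_eq_iff) metis
  obtain p where p: "p \<in> P" "p (F 0) \<noteq> 0"
    using memT[of "F 0"] \<open>F 0 \<in> U\<close> T(2) by auto
  have "continuous_on UNIV (\<lambda>t. p (F t))"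
    by (rule continuous_on_structure_polynomial[of p UNIV F, OF subsetD[OF P(1) p(1)] cont])
  then have "((\<lambda>t. p (F t)) \<longlongrightarrow> p (F 0)) (at 0)"
    by (simp add: continuous_on_def)
  then have "\<forall>\<^sub>F t in at 0. p (F t) \<noteq> 0"
    using p(2) by (rule tendsto_imp_eventually_ne)
  moreover have "\<forall>\<^sub>F t in at (0::complex). t \<noteq> 0"
    by (rule eventually_neq_at_within)
  ultimately have "\<forall>\<^sub>F t in at 0. t \<noteq> 0 \<and> p (F t) \<noteq> 0"
    by eventually_elim simp
  then obtain t where "t \<noteq> 0" "p (F t) \<noteq> 0"
    using eventually_happens[of _ "at (0::complex)"] by auto
  then show ?thesis
    using memT[of "F t"] p(1) T(2) FN[of t] by auto
qed

section \<open>Consequences of a Carnot grading\<close>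

lemma carnot_grading_lower_central:
  assumes "carnot_grading scl br k V" "i \<in> {1..k}"
  shows "lower_central scl br i = family_sum V {i..k}"
  using assms by (simp add: carnot_grading_def)

lemma carnot_grading_disjoint:
  assumes "complex_lie_algebra scl br" and V: "carnot_grading scl br k V"
    and i: "i \<in> {1..<k}" and x: "x \<in> V i" "x \<in> lower_central scl br (Suc i)"
  shows "x = 0"
proof -
  interpret complex_lie_algebra scl br by fact
  have "x \<in> family_sum V {Suc i..k}"
    using x(2) carnot_grading_lower_central[OF V, of "Suc i"] i by simp
  then obtain v where v: "x = (\<Sum>j=Suc i..k. v j)" "\<And>j. j \<in> {Suc i..k} \<Longrightarrow> v j \<in> V j"
    by (auto simp: family_sum_def)
  \<comment> \<open>Degree \<open>i\<close> carries \<open>- x\<close> and the higher degrees carry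
    the components of \<open>x\<close>. These sum to 0, so directness forces \<open>x\<close> to
    vanish.\<close>
  define w where "w j = (if j < i then 0 else if j = i then - x else v j)" for j
  have sub: "\<forall>j\<in>{1..k}. subspace (V j)"
    and unique: "\<forall>v. (\<forall>j\<in>{1..k}. v j \<in> V j) \<and> (\<Sum>j=1..k. v j) = 0 \<longrightarrow> (\<forall>j\<in>{1..k}. v j = 0)"
    using V unfolding carnot_grading_def by - (elim conjE, assumption)+
  have "w j \<in> V j" if "j \<in> {1..k}" for j
    using sub that v(2) x(1) by (auto simp: w_def subspace_0 subspace_neg)
  moreover have "(\<Sum>j=1..k. w j) = 0"
  proof -
    have "(\<Sum>j=1..k. w j) = (\<Sum>j=i..k. w j)"
      using i by (intro sum.mono_neutral_right) (auto simp: w_def)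
    also have "\<dots> = w i + (\<Sum>j=Suc i..k. w j)"
      using i by (intro sum.atLeast_Suc_atMost) auto
    also have "(\<Sum>j=Suc i..k. w j) = x"
      unfolding v(1) by (intro sum.cong) (auto simp: w_def)
    finally show ?thesis
      by (simp add: w_def)
  qed
  ultimately have "w i = 0"
    using unique[rule_format, of w i] i by auto
  then show ?thesis
    by (simp add: w_def)
qed

lemma carnot_grading_complement:
  assumes V: "carnot_grading scl br k V" and "k \<ge> 2"
  shows "\<exists>b\<in>V 1. x - b \<in> lower_central scl br 2"
proof -
  have "x \<in> family_sum V {1..k}"
    using V by (simp add: carnot_grading_def)
  then obtain v where v: "x = (\<Sum>j=1..k. v j)" "\<forall>j\<in>{1..k}. v j \<in> V j"
    by (auto simp: family_sum_def)
  have "x - v 1 = (\<Sum>j=2..k. v j)"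
    using \<open>k \<ge> 2\<close> unfolding v(1) by (simp add: sum.atLeast_Suc_atMost numeral_2_eq_2)
  then have "x - v 1 \<in> lower_central scl br 2"
    using v(2) \<open>k \<ge> 2\<close> carnot_grading_lower_central[OF V, of 2] by (auto simp: family_sum_def)
  then show ?thesis
    using v(2) \<open>k \<ge> 2\<close> by auto
qed

text \<open>If \<open>a\<close> were in the span of \<open>b\<close> and \<open>lc 2\<close>, some
  \<open>a - scl c b\<close> would lie in both \<open>V 1\<close> and \<open>lc 2\<close>, hence be
  0, against independence. Since independence is stated for a set, \<open>a \<noteq> b\<close> keeps
  the pair from collapsing.\<close>

lemma carnot_grading_dual_functional:
  assumes "complex_lie_algebra scl br" and V: "carnot_grading scl br k V" and "k \<ge> 2"
    and ab: "a \<in> V 1" "b \<in> V 1" "a \<noteq> b" "\<not> module.dependent scl {a, b}"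
  shows "\<exists>\<alpha>. Vector_Spaces.linear scl (*) \<alpha> \<and> (\<forall>x\<in>lower_central scl br 2. \<alpha> x = 0)
    \<and> \<alpha> b = 0 \<and> \<alpha> a = (1::complex)"
proof -
  interpret complex_lie_algebra scl br by fact
  have sub: "subspace (V 1)"
    using V \<open>k \<ge> 2\<close> by (auto simp: carnot_grading_def)
  have "a \<notin> span (insert b (lc 2))"
  proof
    assume "a \<in> span (insert b (lc 2))"
    then obtain c where "a - scl c b \<in> span (lc 2)"
      using span_breakdown_eq by blast
    then have "a - scl c b \<in> lc 2"
      using subspace_lower_central by (simp add: span_eq_iff[THEN iffD2])
    moreover have "a - scl c b \<in> V 1"
      using ab sub by (intro subspace_diff subspace_scale)
    ultimately have "a - scl c b = 0"
      using carnot_grading_disjoint[OF assms(1) V, of 1 "a - scl c b"] \<open>k \<ge> 2\<close>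
      by (simp only: numeral_2_eq_2) simp
    then have "a \<in> span {b}"
      by (simp add: span_base span_scale)
    then show False
      using ab(3,4) by (auto simp: dependent_def)
  qed
  then show ?thesis
    by (intro exists_dual_functional subspace_lower_central)
qed

section \<open>Non-rigidity from the curve of deformations\<close>

theorem theorem3p1:
  fixes scl :: "complex \<Rightarrow> 'g::ab_group_add \<Rightarrow> 'g"
    and br :: "'g \<Rightarrow> 'g \<Rightarrow> 'g"
    and V :: "nat \<Rightarrow> 'g set"
    and k :: nat
    and a\<^sub>1 a\<^sub>2 y :: 'g
  assumes "complex_lie_algebra scl br"
    and "vector_space.dim scl (UNIV :: 'g set) = CARD('n::finite)"
    and "k \<ge> 3"
    and "step_nilpotent scl br k"
    and "carnot_grading scl br k V"
    and "a\<^sub>1 \<in> V 1" and "a\<^sub>2 \<in> V 1"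
    and "a\<^sub>1 \<noteq> a\<^sub>2" and "\<not> module.dependent scl {a\<^sub>1, a\<^sub>2}"
    and "br a\<^sub>1 a\<^sub>2 = 0"
    and "y \<in> V k"
    and "y \<notin> bracket_span scl br (lower_central scl br 2) (lower_central scl br 2)
             + br a\<^sub>1 ` lower_central scl br 2
             + br a\<^sub>2 ` lower_central scl br 2"
  shows "\<not> rigid_lie_algebra TYPE('n) k scl br"
proof
  interpret L: complex_lie_algebra scl br by fact
  note lie = assms(1) and V = assms(5)
  assume "rigid_lie_algebra TYPE('n) k scl br"
  then obtain \<mu> :: "complex ^ 'n \<Rightarrow> complex ^ 'n \<Rightarrow> complex ^ 'n" and \<phi>
    where \<phi>: "lie_isomorphism scl br (*s) \<mu> \<phi>" and rigid: "rigid_bracket k \<mu>"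
    unfolding rigid_lie_algebra_def by blast
  have lin\<phi>: "Vector_Spaces.linear scl (*s) \<phi>" and bij\<phi>: "bij \<phi>"
    and hom\<phi>: "\<And>x z. \<phi> (br x z) = \<mu> (\<phi> x) (\<phi> z)"
    using \<phi> by (auto simp: lie_isomorphism_def)
  interpret \<phi>: Vector_Spaces.linear scl "(*s)" \<phi> by (rule lin\<phi>)
  \<comment> \<open>A basis of cardinality \<open>CARD('n)\<close>, which is positive, is finite
    because infinite sets have \<open>card\<close> 0.\<close>
  obtain B where fd: "finite_dimensional_vector_space scl B"
  proof -
    obtain B where B: "L.independent B" "UNIV \<subseteq> L.span B" "card B = CARD('n)"
      using L.basis_exists[of UNIV] unfolding assms(2) by auto
    then have "finite B"
      by (intro card_ge_0_finite) simp
    with B show ?thesis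
      by (intro that[of B]) (unfold_locales, auto)
  qed
  have k: "k \<ge> 2" using \<open>k \<ge> 3\<close> by simp
  \<comment> \<open>This gives independence with the two elements exchanged, as needed for
    \<open>\<beta>\<close>.\<close>
  have "{a\<^sub>2, a\<^sub>1} = {a\<^sub>1, a\<^sub>2}" by blast
  then obtain \<alpha> \<beta> where \<alpha>: "Vector_Spaces.linear scl (*) \<alpha>" "\<And>x. x \<in> L.lc 2 \<Longrightarrow> \<alpha> x = 0"
      "\<alpha> a\<^sub>2 = 0" "\<alpha> a\<^sub>1 = 1"
    and \<beta>: "Vector_Spaces.linear scl (*) \<beta>" "\<And>x. x \<in> L.lc 2 \<Longrightarrow> \<beta> x = 0" "\<beta> a\<^sub>2 = 1"
    using carnot_grading_dual_functional[OF lie V k assms(6,7,8,9)]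
      carnot_grading_dual_functional[OF lie V k assms(7,6)] assms(8,9) by metis
  have yk: "y \<in> L.lc k"
    using carnot_grading_lower_central[OF V, of k] assms(11) k
    by (auto simp: family_sum_def intro: exI[of _ "\<lambda>_. y"])
  have y3: "y \<in> L.lc 3" and y2: "y \<in> L.lc 2"
    using yk L.lower_central_antimono[of _ k] \<open>k \<ge> 3\<close> k by blast+
  have nil: "at_most_step_nilpotent scl br k"
    using assms(4) by (simp add: step_nilpotent_def at_most_step_nilpotent_def)
  \<comment> \<open>Brackets with the last nonzero term of the series fall into the next term, which
    is 0. The index \<open>k - 1\<close> fits the successor form of the lemma.\<close>
  have central: "br x y = 0" for x
    using L.bracket_mem_lower_central[of y "k - 1" x] yk nil k
    by (simp add: at_most_step_nilpotent_def del: lower_central.simps)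
  \<comment> \<open>Scaling \<open>\<alpha>\<close> by \<open>t\<close> makes \<open>D\<close> a
    line of brackets through \<open>br\<close> at \<open>t = 0\<close>. The fixed map
    \<open>\<phi>\<close> then turns it into a curve \<open>F\<close> through
    \<open>\<mu>\<close>.\<close>
  define D where "D t = L.deformation (\<lambda>x. t * \<alpha> x) \<beta> y" for t
  define F where "F t = (\<lambda>x z. \<phi> (D t (inv \<phi> x) (inv \<phi> z)))" for t
  have lin_t: "Vector_Spaces.linear scl (*) (\<lambda>x. t * \<alpha> x)" for t
    using \<alpha>(1) by (simp add: Vector_Spaces.linear_iff algebra_simps)
  have isoF: "lie_isomorphism scl (D t) (*s) (F t) \<phi>" for t
    unfolding F_def by (rule lie_isomorphism_transport[OF lin\<phi> bij\<phi>])
  have "complex_lie_algebra scl (D t)" "at_most_step_nilpotent scl (D t) k" for t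
    unfolding D_def using lin_t \<alpha> \<beta> y2 central nil k
    by (auto intro!: L.complex_lie_algebra_deformation L.at_most_step_nilpotent_deformation)
  then have FN: "F t \<in> nilpotent_brackets k" for t
    using complex_lie_algebra_isomorphism[OF _ isoF] at_most_step_nilpotent_isomorphism[OF _ isoF]
    by (simp add: nilpotent_brackets_def)
  have F0: "F 0 = \<mu>"
    using bij\<phi> by (simp add: F_def D_def L.deformation_def hom\<phi> bij_is_surj surj_f_inv_f)
  have "\<mu> = (\<lambda>x y. id (\<mu> (inv id x) (inv id y)))"
    by simp
  then have "\<mu> \<in> bracket_orbit \<mu>"
    unfolding bracket_orbit_def using vec.linear_id bij_id by blast
  \<comment> \<open>By linearity of \<open>\<phi>\<close>, every structure constant of
    \<open>F t\<close> is an affine function of \<open>t\<close>.\<close>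
  moreover have "continuous_on UNIV (\<lambda>t. F t (axis i 1) (axis j 1) $ l)" for i j l
    unfolding F_def D_def L.deformation_def \<phi>.add \<phi>.scale
    by (auto intro!: continuous_intros)
  ultimately obtain t where t: "t \<noteq> 0" "F t \<in> bracket_orbit \<mu>"
    using zariski_open_meets_curve[of "nilpotent_brackets k" "bracket_orbit \<mu>" F] FN F0 rigid
    unfolding rigid_bracket_def by metis
  then obtain g where "F t = (\<lambda>x y. g (\<mu> (inv g x) (inv g y)))"
    "Vector_Spaces.linear (*s) (*s) g" "bij g"
    unfolding bracket_orbit_def by blast
  then have "lie_isomorphism (*s) \<mu> (*s) (F t) g"
    by (simp add: lie_isomorphism_transport)
  \<comment> \<open>The route is \<open>br\<close> to \<open>\<mu>\<close> by \<open>\<phi>\<close>,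
    then to \<open>F t\<close> by \<open>g\<close>, then back to \<open>D t\<close> by the inverse
    of \<open>\<phi>\<close>.\<close>
  then have "lie_isomorphism scl br scl (D t) (inv \<phi> \<circ> (g \<circ> \<phi>))"
    by (rule lie_isomorphism_comp[OF lie_isomorphism_comp[OF \<phi>] lie_isomorphism_inv[OF isoF]])
  \<comment> \<open>The bracket lies in \<open>V 2\<close>, which meets the third lower central term
    only in 0; \<open>k \<ge> 3\<close> keeps degree 2 strictly below the top.\<close>
  moreover have "br b c = 0" if "b \<in> V 1" "c \<in> V 1" "br b c \<in> L.lc 3" for b c
  proof -
    have "bracket_span scl br (V 1) (V 1) \<subseteq> V 2"
    proof -
      have "\<forall>i\<in>{1..k}. \<forall>j\<in>{1..k}.
          bracket_span scl br (V i) (V j) \<subseteq> (if i + j \<le> k then V (i + j) else {0})"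
        using V unfolding carnot_grading_def by (elim conjE)
      from this[rule_format, of 1 1] show ?thesis
        using \<open>k \<ge> 3\<close> by (simp add: numeral_2_eq_2)
    qed
    then have "br b c \<in> V 2"
      using that(1,2) unfolding bracket_span_def by (blast intro: L.span_base)
    then show ?thesis
      using carnot_grading_disjoint[OF lie V, of 2] that(3) \<open>k \<ge> 3\<close> by (simp add: eval_nat_numeral)
  qed
  ultimately have "y \<in> bracket_span scl br (L.lc 2) (L.lc 2) + br a\<^sub>1 ` L.lc 2 + br a\<^sub>2 ` L.lc 2"
    unfolding D_def
    using \<alpha> \<beta> t(1) assms(10) y3 carnot_grading_complement[OF V k]
    by (intro L.isomorphic_deformation_imp_mem[OF fd lin_t[of t] \<beta>(1), where t = t and W = "V 1"])
      auto
  with assms(12) show False ..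
qed

end
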